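(* If a Banach space $X$ is almost square (ASQ), then for every $x_1,x_2,\ldots,x_N\in S_X$ there exists a sequence $(y_n)\subset B_X$ such that $\|x_i\pm y_n\|\to 1$ for all $i=1,\ldots,N$, $y_n\to 0$ weakly, and $\|y_n\|\to 1$. In particular, every ASQ Banach space is weakly almost square (WASQ).
   Context: All Banach spaces are real. $S_X$ and $B_X$ denote the unit sphere and closed unit ball of $X$. A Banach space $X$ is almost square (ASQ) if for every finite subset $(x_i)_{i=1}^N \subset S_X$ there exists a sequence $(y_n)\subset B_X$ such that $\|x_i\pm y_n\|\to 1$ for every $i=1,\ldots,N$ and $\|y_n\|\to 1$. $X$ is weakly almost square (WASQ) if for every $x\in S_X$ there exists a sequence $(y_n)\subset B_X$ such that $\|x\pm y_n\|\to 1$, $\|y_n\|\to 1$ and $y_n\to 0$ weakly. *)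

theory Defs
  imports "HOL-Analysis.Analysis"
begin

text \<open>
  A real Banach space is a type of class \<open>banach\<close>; its dual is the type
  \<open>'a \<Rightarrow>\<^sub>L real\<close> of bounded linear functionals.
\<close>

definition weakly_tendsto :: "(nat \<Rightarrow> 'a::real_normed_vector) \<Rightarrow> 'a \<Rightarrow> bool" where
  "weakly_tendsto y l \<longleftrightarrow>
     (\<forall>f :: 'a \<Rightarrow>\<^sub>L real. (\<lambda>n. blinfun_apply f (y n)) \<longlonglongrightarrow> blinfun_apply f l)"

text \<open>
  A finite subset is read as a family with indices from 1 to N, where N is at least 1; so
  the empty set is excluded. It would only matter for the zero space, whose unit sphere is
  empty and which therefore satisfies both definitions below vacuously.
\<close>

definition almost_square :: "'a::banach itself \<Rightarrow> bool" where
  "almost_square _ \<longleftrightarrow>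
     (\<forall>F :: 'a set. finite F \<and> F \<noteq> {} \<and> F \<subseteq> sphere 0 1 \<longrightarrow>
       (\<exists>y :: nat \<Rightarrow> 'a.
          (\<forall>n. y n \<in> cball 0 1) \<and>
          (\<forall>x\<in>F. (\<lambda>n. norm (x + y n)) \<longlonglongrightarrow> 1 \<and> (\<lambda>n. norm (x - y n)) \<longlonglongrightarrow> 1) \<and>
          (\<lambda>n. norm (y n)) \<longlonglongrightarrow> 1))"

definition weakly_almost_square :: "'a::banach itself \<Rightarrow> bool" where
  "weakly_almost_square _ \<longleftrightarrow>
     (\<forall>x :: 'a. x \<in> sphere 0 1 \<longrightarrow>
       (\<exists>y :: nat \<Rightarrow> 'a.
          (\<forall>n. y n \<in> cball 0 1) \<and>
          (\<lambda>n. norm (x + y n)) \<longlonglongrightarrow> 1 \<and> (\<lambda>n. norm (x - y n)) \<longlonglongrightarrow> 1 \<and>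
          (\<lambda>n. norm (y n)) \<longlonglongrightarrow> 1 \<and>
          weakly_tendsto y 0))"

end

theory Submission
  imports Defs
begin

text \<open>
  Choose the vectors \<open>y n\<close> recursively, each almost square not only to the given \<open>x i\<close> but also
  to the normalisations of all signed sums of the vectors chosen before. Then adding \<open>\<plusminus>y n\<close> to
  such a sum \<open>s\<close> gives norm at most \<open>max 1 \<parallel>s\<parallel> + (1/2) ^ (n + 1)\<close>, so all signed sums stay in the
  ball of radius 2. Hence the series of the \<open>f (y n)\<close> converges absolutely for every functional
  \<open>f\<close>, and \<open>y n\<close> tends weakly to 0.
\<close>

text \<open>For a functional \<open>f\<close>, taking \<open>e k\<close> to be the sign of
  \<open>f (y k)\<close> turns the sum of the absolute values into \<open>f\<close> of one signed
  sum, which is at most \<open>norm f * C\<close>. So the series converges absolutely and its terms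
  tend to 0.\<close>

lemma weakly_null_if_signed_sums_bounded:
  fixes y :: "nat \<Rightarrow> 'a::real_normed_vector"
  assumes "\<And>e n. (\<forall>k. e k \<in> {-1, 1::real}) \<Longrightarrow> norm (\<Sum>k<n. e k *\<^sub>R y k) \<le> C"
  shows "weakly_tendsto y 0"
  unfolding weakly_tendsto_def
proof
  fix f :: "'a \<Rightarrow>\<^sub>L real"
  define e where "e k = (if f (y k) \<ge> 0 then 1 else -1::real)" for k
  have "(\<Sum>k<n. norm (f (y k))) \<le> norm f * C" for n
  proof -
    have "(\<Sum>k<n. norm (f (y k))) = f (\<Sum>k<n. e k *\<^sub>R y k)"
      by (auto simp: blinfun.sum_right blinfun.scaleR_right e_def intro!: sum.cong)
    also have "\<dots> \<le> norm f * norm (\<Sum>k<n. e k *\<^sub>R y k)"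
      using norm_blinfun[of f "\<Sum>k<n. e k *\<^sub>R y k"] by simp
    also have "\<dots> \<le> norm f * C"
      by (intro mult_left_mono assms) (auto simp: e_def)
    finally show ?thesis .
  qed
  then have "summable (\<lambda>k. norm (f (y k)))"
    by (intro summableI_nonneg_bounded) auto
  then have "(\<lambda>k. f (y k)) \<longlonglongrightarrow> 0"
    by (rule summable_LIMSEQ_zero[OF summable_norm_cancel])
  then show "(\<lambda>k. f (y k)) \<longlonglongrightarrow> f 0"
    by (simp add: blinfun.zero_right)
qed

text \<open>This passes from the unit vector \<open>sgn s\<close> back to \<open>s\<close>. If
  \<open>norm s\<close> is at most 1, then \<open>s + y\<close> is a convex combination of
  \<open>sgn s + y\<close> and \<open>y\<close>; otherwise it differs from \<open>sgn s + y\<close>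
  by a vector of norm \<open>norm s - 1\<close>.\<close>

lemma norm_add_le_max_if_norm_sgn_add_le:
  fixes s y :: "'a::real_normed_vector"
  assumes y: "norm y \<le> 1" and d: "0 \<le> d" and sy: "s \<noteq> 0 \<Longrightarrow> norm (sgn s + y) \<le> 1 + d"
  shows "norm (s + y) \<le> max 1 (norm s) + d"
proof (cases "s = 0")
  case True
  with y d show ?thesis by simp
next
  case False
  define t where "t = norm s"
  have s: "s = t *\<^sub>R sgn s" and t: "0 < t" and u: "norm (sgn s) = 1"
    using False by (auto simp: t_def sgn_div_norm)
  have uy: "norm (sgn s + y) \<le> 1 + d"
    using sy False .
  show ?thesis
  proof (cases "t \<le> 1")
    case True
    have "s + y = t *\<^sub>R sgn s + y"
      using s by metis
    also have "\<dots> = t *\<^sub>R (sgn s + y) + (1 - t) *\<^sub>R y"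
      by (simp add: algebra_simps)
    also have "norm \<dots> \<le> t * norm (sgn s + y) + (1 - t) * norm y"
      using norm_triangle_ineq[of "t *\<^sub>R (sgn s + y)" "(1 - t) *\<^sub>R y"] t True by simp
    also have "\<dots> \<le> t * (1 + d) + (1 - t) * 1"
      using t True uy y by (intro add_mono mult_left_mono) auto
    also have "\<dots> \<le> 1 + d"
      using mult_right_mono[OF True d] by (simp add: algebra_simps)
    finally show ?thesis by simp
  next
    case False
    have "s + y = t *\<^sub>R sgn s + y"
      using s by metis
    also have "\<dots> = (sgn s + y) + (t - 1) *\<^sub>R sgn s"
      by (simp add: algebra_simps)
    also have "norm \<dots> \<le> norm (sgn s + y) + (t - 1)"
      using norm_triangle_ineq[of "sgn s + y" "(t - 1) *\<^sub>R sgn s"] False u by simp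
    also have "\<dots> \<le> t + d"
      using uy by simp
    finally show ?thesis by (simp add: t_def)
  qed
qed

text \<open>Since \<open>F\<close> is finite, only finitely many limits are involved, and a single
  late index of the sequence serves them all.\<close>

lemma almost_square_approx:
  fixes F :: "'a::banach set"
  assumes "almost_square TYPE('a)" "finite F" "F \<noteq> {}" "F \<subseteq> sphere 0 1" "0 < d"
  obtains y where "norm y \<le> 1" "\<bar>norm y - 1\<bar> < d"
    "\<forall>x\<in>F. \<bar>norm (x + y) - 1\<bar> < d \<and> \<bar>norm (x - y) - 1\<bar> < d"
proof -
  obtain y where y: "\<And>n. y n \<in> cball 0 1" "(\<lambda>n. norm (y n)) \<longlonglongrightarrow> 1"
    and F: "\<And>x. x \<in> F \<Longrightarrow> (\<lambda>n. norm (x + y n)) \<longlonglongrightarrow> 1"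
      "\<And>x. x \<in> F \<Longrightarrow> (\<lambda>n. norm (x - y n)) \<longlonglongrightarrow> 1"
    using assms(1-4) unfolding almost_square_def by metis
  have "\<forall>\<^sub>F n in sequentially. \<forall>x\<in>F. \<bar>norm (x + y n) - 1\<bar> < d \<and> \<bar>norm (x - y n) - 1\<bar> < d"
    unfolding eventually_ball_finite_distrib[OF \<open>finite F\<close>] eventually_conj_iff
    using F[THEN tendstoD, OF _ \<open>0 < d\<close>] by (auto simp: dist_real_def)
  moreover have "\<forall>\<^sub>F n in sequentially. \<bar>norm (y n) - 1\<bar> < d"
    using tendstoD[OF y(2) \<open>0 < d\<close>] by (simp add: dist_real_def)
  ultimately obtain n where "\<forall>x\<in>F. \<bar>norm (x + y n) - 1\<bar> < d \<and> \<bar>norm (x - y n) - 1\<bar> < d"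
    "\<bar>norm (y n) - 1\<bar> < d"
    using eventually_happens'[OF sequentially_bot eventually_conj] by blast
  with y(1)[of n] show ?thesis
    by (intro that[of "y n"]) auto
qed

text \<open>Enlarging \<open>F\<close> by the normalisations of the elements of \<open>S\<close>
  yields one vector that also controls the growth of the norms on \<open>S\<close>. This is a single
  step of the recursion.\<close>

lemma almost_square_approx_adding:
  fixes F S :: "'a::banach set"
  assumes "almost_square TYPE('a)" "finite F" "F \<noteq> {}" "F \<subseteq> sphere 0 1" "0 < d" "finite S"
  obtains y where "norm y \<le> 1" "\<bar>norm y - 1\<bar> < d"
    "\<forall>x\<in>F. \<bar>norm (x + y) - 1\<bar> < d \<and> \<bar>norm (x - y) - 1\<bar> < d"
    "\<And>s. s \<in> S \<Longrightarrow> norm (s + y) \<le> max 1 (norm s) + d \<and> norm (s - y) \<le> max 1 (norm s) + d"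
proof -
  \<comment> \<open>Zero is removed because \<open>sgn 0 = 0\<close> lies off the unit sphere; the
    case \<open>s = 0\<close> is covered by \<open>norm y \<le> 1\<close>.\<close>
  have G: "finite (F \<union> sgn ` (S - {0}))" "F \<union> sgn ` (S - {0}) \<noteq> {}"
    "F \<union> sgn ` (S - {0}) \<subseteq> sphere 0 1"
    using assms(2-4,6) by (auto simp: norm_sgn split: if_splits)
  obtain y where y: "norm y \<le> 1" "\<bar>norm y - 1\<bar> < d"
    and F: "\<forall>x\<in>F \<union> sgn ` (S - {0}). \<bar>norm (x + y) - 1\<bar> < d \<and> \<bar>norm (x - y) - 1\<bar> < d"
    by (rule almost_square_approx[OF assms(1) G \<open>0 < d\<close>])
  have "norm (s + z) \<le> max 1 (norm s) + d" if "s \<in> S" "z = y \<or> z = - y" for s z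
  proof (rule norm_add_le_max_if_norm_sgn_add_le)
    show "norm (sgn s + z) \<le> 1 + d" if "s \<noteq> 0"
      using bspec[OF F, of "sgn s"] \<open>s \<in> S\<close> \<open>z = y \<or> z = - y\<close> that by auto
  qed (use y that \<open>0 < d\<close> in auto)
  from this[of _ y] this[of _ "- y"] show ?thesis
    by (intro that[of y]) (use y F in auto)
qed

lemma tendsto_if_dist_less_half_powers:
  fixes a :: "nat \<Rightarrow> real"
  assumes "\<And>n. \<bar>a n - l\<bar> < (1/2) ^ Suc n"
  shows "a \<longlonglongrightarrow> l"
proof (rule LIM_zero_cancel, rule Lim_null_comparison)
  show "\<forall>\<^sub>F n in sequentially. norm (a n - l) \<le> (1/2) ^ Suc n"
    using assms by (intro always_eventually allI) (metis real_norm_def less_imp_le)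
  show "(\<lambda>n. (1/2::real) ^ Suc n) \<longlonglongrightarrow> 0"
    by (intro LIMSEQ_Suc LIMSEQ_power_zero) simp
qed

text \<open>Stated for a set \<open>F\<close>, so that a finite family, through its range, and a
  single vector are both instances.\<close>

lemma almost_square_weakly_null_sequence:
  fixes F :: "'a::banach set"
  assumes "almost_square TYPE('a)" "finite F" "F \<noteq> {}" "F \<subseteq> sphere 0 1"
  obtains y :: "nat \<Rightarrow> 'a" where "\<And>n. y n \<in> cball 0 1" "(\<lambda>n. norm (y n)) \<longlonglongrightarrow> 1"
    "\<And>x. x \<in> F \<Longrightarrow> (\<lambda>n. norm (x + y n)) \<longlonglongrightarrow> 1 \<and> (\<lambda>n. norm (x - y n)) \<longlonglongrightarrow> 1"
    "weakly_tendsto y 0"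
proof -
  define good where "good n S y \<longleftrightarrow> norm y \<le> 1 \<and> \<bar>norm y - 1\<bar> < (1/2) ^ Suc n \<and>
    (\<forall>x\<in>F. \<bar>norm (x + y) - 1\<bar> < (1/2) ^ Suc n \<and> \<bar>norm (x - y) - 1\<bar> < (1/2) ^ Suc n) \<and>
    (\<forall>s\<in>S. norm (s + y) \<le> max 1 (norm s) + (1/2) ^ Suc n \<and>
           norm (s - y) \<le> max 1 (norm s) + (1/2) ^ Suc n)" for n and S :: "'a set" and y
  have ex_good: "\<exists>y. good n S y" if "finite S" for n S
  proof -
    have "(0::real) < (1/2) ^ Suc n" by simp
    from almost_square_approx_adding[OF assms this that] show ?thesis
      unfolding good_def by metis
  qed
  \<comment> \<open>A state \<open>p\<close> pairs a set of signed sums of the earlier vectors with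
    the vector chosen next. Keeping the set in the state lets each choice depend on the previous
    state alone.\<close>
  define step where "step p = (\<lambda>s. s + snd p) ` fst p \<union> (\<lambda>s. s - snd p) ` fst p"
    for p :: "'a set \<times> 'a"
  \<comment> \<open>The bound \<open>2 - (1/2) ^ n\<close> is 1 plus the first \<open>n\<close>
    tolerances \<open>(1/2) ^ Suc k\<close>. At \<open>n = 0\<close> it is 1, and \<open>0\<close>,
    the empty sum, must be present.\<close>
  define P where "P n p \<longleftrightarrow> finite (fst p) \<and> (n = 0 \<longrightarrow> 0 \<in> fst p) \<and>
    (\<forall>s\<in>fst p. norm s \<le> 2 - (1/2) ^ n) \<and> good n (fst p) (snd p)" for n p
  have "\<exists>g. \<forall>n. P n (g n) \<and> fst (g (Suc n)) = step (g n)"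
  proof (rule dependent_nat_choice)
    obtain y where "good 0 {0} y"
      using ex_good[of "{0}" 0] by auto
    then show "\<exists>p. P 0 p"
      by (intro exI[of _ "({0}, y)"]) (auto simp: P_def)
  next
    fix p n
    assume P: "P n p"
    then have "finite (step p)"
      by (simp add: step_def P_def)
    then obtain y where "good (Suc n) (step p) y"
      using ex_good by blast
    moreover have "norm t \<le> 2 - (1/2) ^ Suc n" if t: "t \<in> step p" for t
    proof -
      obtain s where s: "s \<in> fst p" "t = s + snd p \<or> t = s - snd p"
        using t by (auto simp: step_def)
      then have "norm t \<le> max 1 (norm s) + (1/2) ^ Suc n"
        using P by (auto simp: P_def good_def)
      \<comment> \<open>The bound on the sums is at least 1 already, so the maximum does no harm;
        adding \<open>(1/2) ^ Suc n\<close> then gives exactly the bound for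
        \<open>Suc n\<close>.\<close>
      moreover have "max 1 (norm s) \<le> 2 - (1/2) ^ n"
        using P s(1) power_le_one[of "1/2::real" n] by (auto simp: P_def)
      ultimately show ?thesis by (simp add: max_def split: if_splits)
    qed
    ultimately show "\<exists>q. P (Suc n) q \<and> fst q = step p"
      using \<open>finite (step p)\<close> by (intro exI[of _ "(step p, y)"]) (auto simp: P_def)
  qed
  then obtain g where g: "\<And>n. P n (g n)" "\<And>n. fst (g (Suc n)) = step (g n)"
    by blast
  define y where "y n = snd (g n)" for n
  have y: "good n (fst (g n)) (y n)" for n
    using g(1)[of n] by (simp add: P_def y_def)
  have "weakly_tendsto y 0"
  proof (rule weakly_null_if_signed_sums_bounded)
    fix e :: "nat \<Rightarrow> real" and n
    assume e: "\<forall>k. e k \<in> {-1, 1}"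
    \<comment> \<open>The set at stage \<open>n\<close> contains the signed sums of
      \<open>y 0\<close> up to \<open>y (n - 1)\<close>, without \<open>y n\<close>; the sign
      \<open>e n\<close> decides which of the two images in \<open>step\<close> contains the next
      sum.\<close>
    have "(\<Sum>k<n. e k *\<^sub>R y k) \<in> fst (g n)"
    proof (induction n)
      case 0
      then show ?case using g(1)[of 0] by (simp add: P_def)
    next
      case (Suc n)
      then show ?case
        using e[rule_format, of n] by (auto simp: g(2) step_def y_def)
    qed
    then have "norm (\<Sum>k<n. e k *\<^sub>R y k) \<le> 2 - (1/2) ^ n"
      using g(1)[of n] by (simp add: P_def)
    also have "\<dots> \<le> 2" by simp
    finally show "norm (\<Sum>k<n. e k *\<^sub>R y k) \<le> 2" .
  qed
  moreover have "y n \<in> cball 0 1" for n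
    using y by (simp add: good_def)
  moreover have "(\<lambda>n. norm (y n)) \<longlonglongrightarrow> 1"
    using y unfolding good_def by (intro tendsto_if_dist_less_half_powers) blast
  moreover have "(\<lambda>n. norm (x + y n)) \<longlonglongrightarrow> 1" "(\<lambda>n. norm (x - y n)) \<longlonglongrightarrow> 1" if "x \<in> F" for x
    using y that unfolding good_def by (intro tendsto_if_dist_less_half_powers; blast)+
  ultimately show ?thesis
    using that by blast
qed

theorem theorem2p8:
  assumes "almost_square TYPE('a::banach)"
  shows "(\<forall>(N::nat) (x :: nat \<Rightarrow> 'a). N \<ge> 1 \<and> (\<forall>i\<in>{1..N}. x i \<in> sphere 0 1) \<longrightarrow>
           (\<exists>y :: nat \<Rightarrow> 'a.
              (\<forall>n. y n \<in> cball 0 1) \<and>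
              (\<forall>i\<in>{1..N}. (\<lambda>n. norm (x i + y n)) \<longlonglongrightarrow> 1 \<and> (\<lambda>n. norm (x i - y n)) \<longlonglongrightarrow> 1) \<and>
              weakly_tendsto y 0 \<and>
              (\<lambda>n. norm (y n)) \<longlonglongrightarrow> 1))
         \<and> weakly_almost_square TYPE('a)"
proof
  show "\<forall>(N::nat) (x :: nat \<Rightarrow> 'a). N \<ge> 1 \<and> (\<forall>i\<in>{1..N}. x i \<in> sphere 0 1) \<longrightarrow>
           (\<exists>y :: nat \<Rightarrow> 'a.
              (\<forall>n. y n \<in> cball 0 1) \<and>
              (\<forall>i\<in>{1..N}. (\<lambda>n. norm (x i + y n)) \<longlonglongrightarrow> 1 \<and> (\<lambda>n. norm (x i - y n)) \<longlonglongrightarrow> 1) \<and>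
              weakly_tendsto y 0 \<and>
              (\<lambda>n. norm (y n)) \<longlonglongrightarrow> 1)"
  proof (intro allI impI)
    fix N :: nat and x :: "nat \<Rightarrow> 'a"
    assume x: "N \<ge> 1 \<and> (\<forall>i\<in>{1..N}. x i \<in> sphere 0 1)"
    \<comment> \<open>Nonemptiness comes from \<open>N \<ge> 1\<close>; repetitions among the
      \<open>x i\<close> are harmless, since the conditions concern only their values.\<close>
    then have "x ` {1..N} \<noteq> {}" "x ` {1..N} \<subseteq> sphere 0 1"
      by auto
    then obtain y where "\<And>n. y n \<in> cball 0 1" "(\<lambda>n. norm (y n)) \<longlonglongrightarrow> 1"
      "\<And>z. z \<in> x ` {1..N} \<Longrightarrow> (\<lambda>n. norm (z + y n)) \<longlonglongrightarrow> 1 \<and> (\<lambda>n. norm (z - y n)) \<longlonglongrightarrow> 1"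
      "weakly_tendsto y 0"
      using almost_square_weakly_null_sequence[OF assms, of "x ` {1..N}"] by blast
    then show "\<exists>y :: nat \<Rightarrow> 'a.
              (\<forall>n. y n \<in> cball 0 1) \<and>
              (\<forall>i\<in>{1..N}. (\<lambda>n. norm (x i + y n)) \<longlonglongrightarrow> 1 \<and> (\<lambda>n. norm (x i - y n)) \<longlonglongrightarrow> 1) \<and>
              weakly_tendsto y 0 \<and>
              (\<lambda>n. norm (y n)) \<longlonglongrightarrow> 1"
      by (intro exI[of _ y]) blast
  qed
next
  show "weakly_almost_square TYPE('a)"
    unfolding weakly_almost_square_def
  proof (intro allI impI)
    fix x :: 'a
    assume "x \<in> sphere 0 1"
    then obtain y where "\<And>n. y n \<in> cball 0 1" "(\<lambda>n. norm (y n)) \<longlonglongrightarrow> 1"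
      "\<And>z. z \<in> {x} \<Longrightarrow> (\<lambda>n. norm (z + y n)) \<longlonglongrightarrow> 1 \<and> (\<lambda>n. norm (z - y n)) \<longlonglongrightarrow> 1"
      "weakly_tendsto y 0"
      using almost_square_weakly_null_sequence[OF assms, of "{x}"] by blast
    then show "\<exists>y :: nat \<Rightarrow> 'a.
          (\<forall>n. y n \<in> cball 0 1) \<and>
          (\<lambda>n. norm (x + y n)) \<longlonglongrightarrow> 1 \<and> (\<lambda>n. norm (x - y n)) \<longlonglongrightarrow> 1 \<and>
          (\<lambda>n. norm (y n)) \<longlonglongrightarrow> 1 \<and>
          weakly_tendsto y 0"
      by (intro exI[of _ y]) blast
  qed
qed

end
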